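(* For all $a,b>0$ with $a\ne b$, $$\sqrt{\frac{8}{\pi e}}\,\frac{A+G}{2}<\sqrt{PX}<\frac{A+G}{2}$$ and $$\sqrt{AG}<\sqrt{PX}<\frac{A+G}{2}.$$
   Context: For $a,b>0$ with $a\neq b$: $A=\frac{a+b}{2}$, $G=\sqrt{ab}$, $P=\frac{a-b}{2\arcsin\frac{a-b}{a+b}}$ (first Seiffert mean), and $X=A e^{G/P-1}$. *)

theory Defs
  imports Complex_Main
begin

definition arith_mean :: "real \<Rightarrow> real \<Rightarrow> real" where
  "arith_mean a b = (a + b) / 2"

definition geom_mean :: "real \<Rightarrow> real \<Rightarrow> real" where
  "geom_mean a b = sqrt (a * b)"

text \<open>The first Seiffert mean. Only the values at positive \<open>a \<noteq> b\<close> are meaningful;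
  the formula is not extended by continuity to \<open>a = b\<close>.\<close>

definition seiffert_mean :: "real \<Rightarrow> real \<Rightarrow> real" where
  "seiffert_mean a b = (a - b) / (2 * arcsin ((a - b) / (a + b)))"

definition X_mean :: "real \<Rightarrow> real \<Rightarrow> real" where
  "X_mean a b = arith_mean a b * exp (geom_mean a b / seiffert_mean a b - 1)"

end

theory Submission
  imports Defs
begin

text \<open>With \<open>t = arcsin (\<bar>a - b\<bar> / (a + b))\<close> one has \<open>G = A cos t\<close>, \<open>P = A sin t / t\<close> and
  \<open>X = A exp (t cot t - 1)\<close>, where \<open>0 < t < pi / 2\<close>. The logarithm of \<open>P X / ((A + G) / 2)\<^sup>2\<close> is
  a function of \<open>t\<close> with derivative \<open>- (1 - t / sin t)\<^sup>2 / t\<close>. It decreases from its limit \<open>0\<close> at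
  \<open>t = 0\<close> to its value \<open>ln (8 / (pi e))\<close> at \<open>t = pi / 2\<close>, which gives the bounds in terms of
  \<open>(A + G) / 2\<close>. The remaining bound \<open>A G < P X\<close> is \<open>x < exp (x - 1)\<close> at \<open>x = t cot t \<noteq> 1\<close>.\<close>

section \<open>The logarithmic ratio and its derivative\<close>

definition log_ratio :: "real \<Rightarrow> real" where
  "log_ratio t = ln (sin t / t) + cos t / (sin t / t) - 1 - 2 * ln ((1 + cos t) / 2)"

lemma sin_over_self_pos:
  fixes t :: real
  assumes "0 < t" "t \<le> pi / 2"
  shows "sin t / t > 0"
  using assms pi_gt_zero by (intro divide_pos_pos sin_gt_zero) linarith+

lemma log_ratio_deriv:
  assumes "0 < t" "t \<le> pi / 2"
  shows "(log_ratio has_real_derivative - ((1 - t / sin t)\<^sup>2 / t)) (at t)"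
proof -
  have s: "sin t > 0"
    using assms pi_gt_zero by (intro sin_gt_zero) linarith+
  have c: "cos t \<ge> 0"
    using assms by (intro cos_ge_zero) auto
  then have c': "1 + cos t > 0"
    by simp
  \<comment> \<open>Both sides are 2 tan(t/2). The right-hand form has denominator
    \<open>sin t\<close>, like the cotangent terms it is to be combined with.\<close>
  have half: "2 * (sin t / (1 + cos t)) = 2 * (1 - cos t) / sin t"
  proof -
    have "sin t * sin t = (1 - cos t) * (1 + cos t)"
      using sin_cos_squared_add[of t] by (simp add: algebra_simps power2_eq_square)
    then have "2 * sin t * sin t = 2 * (1 - cos t) * (1 + cos t)"
      by (simp only: mult.assoc)
    moreover have "sin t \<noteq> 0" "1 + cos t \<noteq> 0"
      using s c' by simp_all
    ultimately show ?thesis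
      unfolding times_divide_eq_right by (subst frac_eq_eq)
  qed
  have sinc: "((\<lambda>t. sin t / t) has_real_derivative (cos t * t - sin t) / (t * t)) (at t)"
    using DERIV_divide[OF DERIV_sin DERIV_ident, of t] assms by simp
  have sinc_pos: "sin t / t > 0"
    using s assms by simp
  have ln_sinc: "((\<lambda>t. ln (sin t / t)) has_real_derivative cos t / sin t - 1 / t) (at t)"
    by (rule DERIV_cong[OF DERIV_chain2[OF DERIV_ln_divide[OF sinc_pos] sinc]])
      (use s assms in \<open>simp add: divide_simps\<close>)
  \<comment> \<open>The sum of squares is kept unevaluated, so that the quotient rule is checked by
    clearing denominators alone. It becomes 1 only when the terms are collected.\<close>
  have cot: "((\<lambda>t. cos t / (sin t / t)) has_real_derivative
      cos t / sin t - t * ((sin t)\<^sup>2 + (cos t)\<^sup>2) / (sin t)\<^sup>2) (at t)"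
    by (rule DERIV_cong[OF DERIV_divide[OF DERIV_cos sinc]])
      (use s assms in \<open>simp_all add: field_simps power2_eq_square
        del: sin_cos_squared_add sin_cos_squared_add2 sin_cos_squared_add3\<close>)
  have half_pos: "(1 + cos t) / 2 > 0"
    using c' by simp
  have half_deriv: "((\<lambda>t. (1 + cos t) / 2) has_real_derivative - sin t / 2) (at t)"
    by (auto intro!: derivative_eq_intros)
  have ln_half: "((\<lambda>t. ln ((1 + cos t) / 2)) has_real_derivative
      - (sin t / (1 + cos t))) (at t)"
    by (rule DERIV_cong[OF DERIV_chain2[OF DERIV_ln_divide[OF half_pos] half_deriv]])
      (use c' in \<open>simp add: divide_simps\<close>)
  have "(log_ratio has_real_derivative
      (cos t / sin t - 1 / t) + (cos t / sin t - t * ((sin t)\<^sup>2 + (cos t)\<^sup>2) / (sin t)\<^sup>2)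
      - 0 - 2 * - (sin t / (1 + cos t))) (at t)"
    unfolding log_ratio_def[abs_def]
    by (intro DERIV_diff DERIV_add DERIV_cmult DERIV_const ln_sinc cot ln_half)
  also have "(cos t / sin t - 1 / t) + (cos t / sin t - t * ((sin t)\<^sup>2 + (cos t)\<^sup>2) / (sin t)\<^sup>2)
      - 0 - 2 * - (sin t / (1 + cos t))
    = cos t / sin t - 1 / t + (cos t / sin t - t / (sin t)\<^sup>2) + 2 * (1 - cos t) / sin t"
    using half by simp
  \<comment> \<open>The cosine terms cancel, and
    \<open>- 1 / t + 2 / sin t - t / (sin t)\<^sup>2\<close> is minus a perfect square over
    \<open>t\<close>.\<close>
  also have "\<dots> = - ((1 - t / sin t)\<^sup>2 / t)"
    using s assms by (simp add: field_simps power2_eq_square)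
  finally show ?thesis .
qed

section \<open>Strict trigonometric inequalities\<close>

text \<open>The difference \<open>x - sin x\<close> vanishes at 0 and has derivative
  \<open>1 - cos x\<close>. Strictness keeps the derivative of \<open>log_ratio\<close> away from
  0.\<close>

lemma sin_less_self:
  fixes x :: real
  assumes "0 < x" "x \<le> pi / 2"
  shows "sin x < x"
proof -
  have "0 - sin 0 < x - sin x"
  proof (rule DERIV_pos_imp_increasing_open[OF \<open>0 < x\<close>])
    fix y :: real assume y: "0 < y" "y < x"
    have "cos y < 1"
      using cos_monotone_0_pi[of 0 y] y assms pi_gt_zero by simp
    moreover have "((\<lambda>y. y - sin y) has_real_derivative 1 - cos y) (at y)"
      by (auto intro!: derivative_eq_intros)
    ultimately show "\<exists>d. ((\<lambda>y. y - sin y) has_real_derivative d) (at y) \<and> d > 0"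
      by (intro exI[of _ "1 - cos y"]) simp
  qed (auto intro!: continuous_intros)
  then show ?thesis
    by simp
qed

text \<open>The difference of the sides vanishes at 0 and has derivative \<open>x * sin x\<close>.
  This yields t cot t < 1, hence the strict bound on A G.\<close>

lemma self_mult_cos_less_sin:
  fixes x :: real
  assumes "0 < x" "x \<le> pi / 2"
  shows "x * cos x < sin x"
proof -
  have "sin 0 - 0 * cos 0 < sin x - x * cos x"
  proof (rule DERIV_pos_imp_increasing_open[OF \<open>0 < x\<close>])
    fix y :: real assume y: "0 < y" "y < x"
    have "sin y > 0"
      using y assms by (intro sin_gt_zero2) auto
    then have "y * sin y > 0"
      using y by simp
    moreover have "((\<lambda>y. sin y - y * cos y) has_real_derivative y * sin y) (at y)"
      by (auto intro!: derivative_eq_intros)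
    ultimately show "\<exists>d. ((\<lambda>y. sin y - y * cos y) has_real_derivative d) (at y) \<and> d > 0"
      by blast
  qed (auto intro!: continuous_intros)
  then show ?thesis
    by simp
qed

section \<open>Monotonicity and end values of the logarithmic ratio\<close>

lemma log_ratio_strict_antimono:
  assumes "0 < s" "s < t" "t \<le> pi / 2"
  shows "log_ratio t < log_ratio s"
proof (rule DERIV_neg_imp_decreasing[OF \<open>s < t\<close>])
  fix x assume x: "s \<le> x" "x \<le> t"
  have "0 < sin x"
    using x assms pi_gt_zero by (intro sin_gt_zero) linarith+
  moreover have "sin x < x"
    using x assms by (intro sin_less_self) auto
  ultimately have "1 - x / sin x \<noteq> 0"
    by (simp add: field_simps)
  then have "- ((1 - x / sin x)\<^sup>2 / x) < 0"
    using x assms by simp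
  then show "\<exists>y. (log_ratio has_real_derivative y) (at x) \<and> y < 0"
    using log_ratio_deriv[of x] x assms by (meson less_le_trans order_trans)
qed

text \<open>Writing t cot t as \<open>cos t / (sin t / t)\<close> makes \<open>log_ratio\<close> an
  expression in \<open>sin t / t\<close> and \<open>cos t\<close> alone. Both tend to 1.\<close>

lemma log_ratio_tendsto_0: "(log_ratio \<longlongrightarrow> 0) (at_right 0)"
proof -
  have "((\<lambda>t::real. sin t / t) \<longlongrightarrow> 1) (at 0)"
    using DERIV_sin[of "0::real"] by (simp add: has_field_derivative_iff)
  then have sinc: "((\<lambda>t::real. sin t / t) \<longlongrightarrow> 1) (at_right 0)"
    by (rule tendsto_within_subset) simp
  have cos: "((\<lambda>t::real. cos t) \<longlongrightarrow> 1) (at_right 0)"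
    by (rule tendsto_eq_intros refl | simp)+
  have "((\<lambda>t. ln (sin t / t) + cos t / (sin t / t) - 1 - 2 * ln ((1 + cos t) / 2))
      \<longlongrightarrow> ln 1 + 1 / 1 - 1 - 2 * ln ((1 + 1) / 2 :: real)) (at_right 0)"
    by (intro tendsto_intros sinc cos) auto
  then show ?thesis
    unfolding log_ratio_def[abs_def] by simp
qed

text \<open>Passing to the limit at 0 preserves only a weak inequality. It is therefore applied at
  \<open>t / 2\<close>, and the decrease from \<open>t / 2\<close> to \<open>t\<close> restores
  strictness.\<close>

lemma log_ratio_neg:
  assumes "0 < t" "t \<le> pi / 2"
  shows "log_ratio t < 0"
proof -
  have "eventually (\<lambda>s. s \<in> {0<..<t / 2}) (at_right 0)"
    using assms by (intro eventually_at_right_real) simp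
  then have "eventually (\<lambda>s. log_ratio (t / 2) \<le> log_ratio s) (at_right 0)"
  proof (rule eventually_mono)
    fix s assume "s \<in> {0<..<t / 2}"
    then show "log_ratio (t / 2) \<le> log_ratio s"
      using assms by (intro less_imp_le log_ratio_strict_antimono) auto
  qed
  then have "log_ratio (t / 2) \<le> 0"
    by (intro tendsto_lowerbound[OF log_ratio_tendsto_0]) auto
  moreover have "log_ratio t < log_ratio (t / 2)"
    using assms by (intro log_ratio_strict_antimono) auto
  ultimately show ?thesis
    by linarith
qed

lemma log_ratio_pi_half: "log_ratio (pi / 2) = ln (8 / (pi * exp 1))"
proof -
  \<comment> \<open>The value at \<open>pi / 2\<close> is 3 ln 2 - ln pi - 1: one ln 2 comes from
    \<open>ln (sin t / t)\<close>, two from the last term.\<close>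
  have "ln (8 :: real) = 3 * ln 2"
    using ln_realpow[of "2 :: real" 3] by simp
  then show ?thesis
    by (simp add: log_ratio_def ln_div ln_mult)
qed

text \<open>The left side will be P X / \<open>A\<^sup>2\<close>, and the square on the right is
  that of (A + G) / (2 A).\<close>

lemma exp_log_ratio:
  assumes "0 < t" "t \<le> pi / 2"
  shows "sin t / t * exp (t * cos t / sin t - 1) = exp (log_ratio t) * ((1 + cos t) / 2)\<^sup>2"
proof -
  have "cos t \<ge> 0"
    using assms by (intro cos_ge_zero) auto
  then have "exp (2 * ln ((1 + cos t) / 2)) = ((1 + cos t) / 2)\<^sup>2"
    by (simp add: exp_double)
  moreover have "exp (ln (sin t / t)) = sin t / t"
    using sin_over_self_pos[OF assms] by simp
  moreover have "t * cos t / sin t = cos t / (sin t / t)"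
    by simp
  ultimately show ?thesis
    using \<open>cos t \<ge> 0\<close> unfolding log_ratio_def exp_add exp_diff
    by simp
qed

text \<open>For x = t cot t, multiplying \<open>x < exp (x - 1)\<close> by \<open>sin t / t\<close>
  turns its left side into \<open>cos t\<close>.\<close>

lemma cos_less_sinc_exp:
  fixes t :: real
  assumes "0 < t" "t < pi / 2"
  shows "cos t < sin t / t * exp (t * cos t / sin t - 1)"
proof -
  have s: "sin t > 0"
    using assms pi_gt_zero by (intro sin_gt_zero) linarith+
  define x where "x = t * cos t / sin t"
  have "x < 1"
    unfolding x_def using self_mult_cos_less_sin[of t] s assms by simp
  then have "x < exp (x - 1)"
    using exp_minus_greater[of "1 - x"] by simp
  then have "sin t / t * x < sin t / t * exp (x - 1)"
    using s assms by (intro mult_strict_left_mono) auto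
  then show ?thesis
    using s assms by (simp add: x_def)
qed

section \<open>The means in terms of the angle\<close>

lemma arcsin_parametrization:
  fixes a b :: real
  assumes "0 < b" "b < a"
  obtains t where "0 < t" "t < pi / 2"
    "geom_mean a b = arith_mean a b * cos t"
    "seiffert_mean a b * X_mean a b
      = (arith_mean a b)\<^sup>2 * (sin t / t * exp (t * cos t / sin t - 1))"
proof -
  define A where "A = arith_mean a b"
  define x where "x = (a - b) / (a + b)"
  define t where "t = arcsin x"
  have A: "A > 0"
    using assms by (simp add: A_def arith_mean_def)
  have x: "0 < x" "x < 1"
    using assms by (simp_all add: x_def)
  have sin: "sin t = x"
    using x by (simp add: t_def)
  have t: "0 < t" "t < pi / 2"
    using x arcsin_less_mono[of 0 x] arcsin_less_mono[of x 1] by (simp_all add: t_def)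
  have c: "cos t > 0"
    using t by (intro cos_gt_zero) auto
  have ab: "a - b = 2 * (A * sin t)" "a + b = 2 * A"
    using assms unfolding sin x_def A_def arith_mean_def by (simp_all add: divide_simps)
  \<comment> \<open>The product of these two forms is a difference of squares, from which G is read
    off.\<close>
  have "a = A * (1 + sin t)" "b = A * (1 - sin t)"
    using ab by (simp_all add: algebra_simps)
  then have "a * b = A * (1 + sin t) * (A * (1 - sin t))"
    by (rule arg_cong2[where f = "(*)"])
  also have "\<dots> = A\<^sup>2 * (1 - (sin t)\<^sup>2)"
    by (simp add: algebra_simps power2_eq_square)
  also have "\<dots> = (A * cos t)\<^sup>2"
    by (simp add: cos_squared_eq power_mult_distrib)
  finally have G: "geom_mean a b = A * cos t"
    unfolding geom_mean_def using A c by simp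
  have P: "seiffert_mean a b = A * (sin t / t)"
    unfolding seiffert_mean_def x_def[symmetric] t_def[symmetric]
    unfolding ab by simp
  \<comment> \<open>The factor \<open>A\<close> cancels in G / P, leaving t cot t.\<close>
  have "X_mean a b = A * exp (t * cos t / sin t - 1)"
    unfolding X_mean_def G P A_def[symmetric] using A by (simp add: mult.commute)
  with P have "seiffert_mean a b * X_mean a b = A\<^sup>2 * (sin t / t * exp (t * cos t / sin t - 1))"
    by (simp add: power2_eq_square)
  with t G show thesis
    unfolding A_def by (rule that)
qed

text \<open>Up to the factor \<open>M\<close>, the square of (A + G) / 2, the first two bounds
  compare \<open>log_ratio t\<close> with its value at \<open>pi / 2\<close> and with 0. All three
  are stated for squares, so that roots enter only at the end.\<close>

lemma seiffert_X_bounds: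
  fixes a b :: real
  assumes "0 < b" "b < a"
  shows "8 / (pi * exp 1) * ((arith_mean a b + geom_mean a b) / 2)\<^sup>2
      < seiffert_mean a b * X_mean a b"
    and "seiffert_mean a b * X_mean a b < ((arith_mean a b + geom_mean a b) / 2)\<^sup>2"
    and "arith_mean a b * geom_mean a b < seiffert_mean a b * X_mean a b"
proof -
  define A where "A = arith_mean a b"
  have A: "A > 0"
    using assms by (simp add: A_def arith_mean_def)
  obtain t where t: "0 < t" "t < pi / 2" and G: "geom_mean a b = A * cos t"
    and PX: "seiffert_mean a b * X_mean a b = A\<^sup>2 * (sin t / t * exp (t * cos t / sin t - 1))"
    using arcsin_parametrization[OF assms] unfolding A_def by metis
  define M where "M = (A * ((1 + cos t) / 2))\<^sup>2"
  have "cos t > 0"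
    using t by (intro cos_gt_zero) auto
  with A have M: "M > 0"
    by (simp add: M_def)
  have sum: "((A + A * cos t) / 2)\<^sup>2 = M"
    by (simp add: M_def algebra_simps)
  have PX_M: "seiffert_mean a b * X_mean a b = exp (log_ratio t) * M"
    unfolding PX M_def using t by (subst exp_log_ratio) (simp_all only: power_mult_distrib mult.left_commute order_less_imp_le)
  have "ln (8 / (pi * exp 1)) < log_ratio t"
    using log_ratio_strict_antimono[of t "pi / 2"] t by (simp add: log_ratio_pi_half)
  then have "exp (ln (8 / (pi * exp 1))) < exp (log_ratio t)"
    by (simp only: exp_less_cancel_iff)
  then have "8 / (pi * exp 1) < exp (log_ratio t)"
    by (subst (asm) exp_ln) simp_all
  then show "8 / (pi * exp 1) * ((arith_mean a b + geom_mean a b) / 2)\<^sup>2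
      < seiffert_mean a b * X_mean a b"
    unfolding G A_def[symmetric] sum PX_M using M by (rule mult_strict_right_mono)
  show "seiffert_mean a b * X_mean a b < ((arith_mean a b + geom_mean a b) / 2)\<^sup>2"
    unfolding G A_def[symmetric] sum PX_M using M log_ratio_neg[of t] t by simp
  have "A\<^sup>2 * cos t < A\<^sup>2 * (sin t / t * exp (t * cos t / sin t - 1))"
    using A cos_less_sinc_exp[OF t] by (intro mult_strict_left_mono) auto
  then show "arith_mean a b * geom_mean a b < seiffert_mean a b * X_mean a b"
    unfolding G PX A_def[symmetric] by (simp add: power2_eq_square)
qed

section \<open>Symmetry and the final inequalities\<close>

lemma arith_mean_commute: "arith_mean a b = arith_mean b a"
  by (simp add: arith_mean_def)

lemma geom_mean_commute: "geom_mean a b = geom_mean b a"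
  by (simp add: geom_mean_def mult.commute)

text \<open>Numerator and arcsine both change sign under the swap. Positivity puts the argument in
  [-1, 1], where the arcsine is odd.\<close>

lemma seiffert_mean_commute:
  assumes "0 < a" "0 < b"
  shows "seiffert_mean a b = seiffert_mean b a"
proof -
  have "arcsin ((a - b) / (a + b)) = arcsin (- ((b - a) / (b + a)))"
    by (metis add.commute minus_diff_eq minus_divide_left)
  also have "\<dots> = - arcsin ((b - a) / (b + a))"
    using assms by (intro arcsin_minus) (simp_all add: field_simps)
  finally have "seiffert_mean a b = (a - b) / - (2 * arcsin ((b - a) / (b + a)))"
    by (simp add: seiffert_mean_def)
  also have "\<dots> = seiffert_mean b a"
    unfolding seiffert_mean_def by (metis minus_diff_eq minus_divide_divide minus_minus)
  finally show ?thesis .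
qed

lemma X_mean_commute:
  assumes "0 < a" "0 < b"
  shows "X_mean a b = X_mean b a"
  using assms by (simp add: X_mean_def arith_mean_commute[of a] geom_mean_commute[of a]
      seiffert_mean_commute[of a])

theorem proposition6:
  fixes a b :: real
  assumes "a > 0" and "b > 0" and "a \<noteq> b"
  defines "A \<equiv> arith_mean a b"
    and "G \<equiv> geom_mean a b"
    and "P \<equiv> seiffert_mean a b"
    and "X \<equiv> X_mean a b"
  shows "(sqrt (8 / (pi * exp 1)) * ((A + G) / 2) < sqrt (P * X)
            \<and> sqrt (P * X) < (A + G) / 2)
       \<and> (sqrt (A * G) < sqrt (P * X)
            \<and> sqrt (P * X) < (A + G) / 2)"
proof -
  have bounds: "8 / (pi * exp 1) * ((A + G) / 2)\<^sup>2 < P * X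
      \<and> P * X < ((A + G) / 2)\<^sup>2 \<and> A * G < P * X"
  proof (cases "b < a")
    case True
    then show ?thesis
      unfolding A_def G_def P_def X_def using seiffert_X_bounds[OF \<open>b > 0\<close>] by blast
  next
    case False
    then have "a < b"
      using \<open>a \<noteq> b\<close> by simp
    then show ?thesis
      unfolding A_def G_def P_def X_def arith_mean_commute[of a] geom_mean_commute[of a]
        seiffert_mean_commute[OF \<open>a > 0\<close> \<open>b > 0\<close>] X_mean_commute[OF \<open>a > 0\<close> \<open>b > 0\<close>]
      using seiffert_X_bounds[OF \<open>a > 0\<close>] by blast
  qed
  have pos: "(A + G) / 2 > 0"
    using assms by (simp add: A_def G_def arith_mean_def geom_mean_def add_pos_pos)
  \<comment> \<open>Positivity of (A + G) / 2 lets it move under the root as its square.\<close>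
  have "sqrt (8 / (pi * exp 1)) * ((A + G) / 2) = sqrt (8 / (pi * exp 1) * ((A + G) / 2)\<^sup>2)"
    using pos by (simp only: real_sqrt_mult real_sqrt_abs abs_of_pos)
  also have "\<dots> < sqrt (P * X)"
    using bounds by (simp only: real_sqrt_less_iff)
  finally have lower: "sqrt (8 / (pi * exp 1)) * ((A + G) / 2) < sqrt (P * X)" .
  have "sqrt (P * X) < sqrt (((A + G) / 2)\<^sup>2)"
    using bounds by (simp only: real_sqrt_less_iff)
  also have "\<dots> = (A + G) / 2"
    using pos by (simp only: real_sqrt_abs abs_of_pos)
  finally have upper: "sqrt (P * X) < (A + G) / 2" .
  show ?thesis
    using lower upper bounds by simp
qed

end
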